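(* For nonnegative integers $m,n$ and any number $\alpha\neq 0$, \[ \sum_{a=1}^{m}\sum_{b=1}^{n}\binom{(1+\alpha)m-a+b-1}{m-a}\binom{(1+\alpha^{-1})n+a-b-1}{n-b} =\frac{mn}{(1+\alpha)(m+\alpha^{-1}n)}\binom{(1+\alpha)m}{m}\binom{(1+\alpha^{-1})n}{n}. \]
   Context: For an arbitrary (complex) number $z$ and an integer $k$, the binomial coefficient is $\binom{z}{k}=\frac{z(z-1)\cdots(z-k+1)}{k!}$ for $k\ge 0$ and $\binom{z}{k}=0$ for $k<0$. An empty sum is $0$.
   Formalization: The right side is undefined when (1+α)(m+n/α)=0 (e.g. m=n=1, α=−1); the equation is proved where this is nonzero, and for m=0 or n=0 with both sides 0; at the remaining α≠0 the right side is read as its limit, which equals the double sum. *)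

theory Defs
  imports Complex_Main
begin

(* Only lower indices m - a with a \<le> m and n - b with b \<le> n occur, so the natural-number
   subtraction is exact and the convention for negative lower indices is never used. *)
definition double_sum :: "nat \<Rightarrow> nat \<Rightarrow> complex \<Rightarrow> complex" where
  "double_sum m n \<alpha> =
     (\<Sum>a=1..m. \<Sum>b=1..n.
        (((1 + \<alpha>) * of_nat m - of_nat a + of_nat b - 1) gchoose (m - a)) *
        (((1 + inverse \<alpha>) * of_nat n + of_nat a - of_nat b - 1) gchoose (n - b)))"

definition closed_denom :: "nat \<Rightarrow> nat \<Rightarrow> complex \<Rightarrow> complex" where
  "closed_denom m n \<alpha> = (1 + \<alpha>) * (of_nat m + inverse \<alpha> * of_nat n)"

(* Where the denominator vanishes (alpha = -1 or alpha * m = - n) the quotient on the right is not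
   defined literally.  If m = 0 or n = 0 it is read as 0; in general, such an alpha is a removable
   singularity and the right-hand side is read as its limit there. *)
definition closed_form :: "nat \<Rightarrow> nat \<Rightarrow> complex \<Rightarrow> complex" where
  "closed_form m n \<alpha> =
     of_nat m * of_nat n / closed_denom m n \<alpha> *
     (((1 + \<alpha>) * of_nat m) gchoose m) * (((1 + inverse \<alpha>) * of_nat n) gchoose n)"

end

theory Submission
  imports Defs "HOL-Computational_Algebra.Formal_Power_Series"
begin

unbundle fps_syntax

text \<open>
  Put \<open>x = \<alpha> m\<close> and \<open>y = n / \<alpha>\<close>, so that \<open>x y = m n\<close> and the denominator is \<open>m + n + x + y\<close>.
  With \<open>F = (1 - u)\<^sup>-\<^sup>x (1 - v)\<^sup>-\<^sup>y\<close>, \<open>U = 1 / (1 - u)\<close>, \<open>V = 1 / (1 - v)\<close> and \<open>W = 1 / (1 - u - v)\<close>,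
  two geometric series show that the double sum is the coefficient of \<open>u\<^sup>m v\<^sup>n\<close> in \<open>F u v W\<^sup>2\<close>,
  while the product of the two binomial coefficients on the right is its coefficient in \<open>F U V\<close>.
  For the Euler operators \<open>\<theta>\<^sub>u = u \<partial>/\<partial>u\<close> and \<open>\<theta>\<^sub>v = v \<partial>/\<partial>v\<close> one has
  \<open>(\<theta>\<^sub>u + \<theta>\<^sub>v + x + y) (F u v W\<^sup>2) - \<theta>\<^sub>u \<theta>\<^sub>v (F U V) = (\<theta>\<^sub>u \<theta>\<^sub>v - x y) (F (W - U V))\<close>,
  and on the coefficient of \<open>u\<^sup>m v\<^sup>n\<close> the operator on the right acts as \<open>m n - x y = 0\<close>.
  At the zeros of the denominator the claim follows by continuity of the double sum.

  Bivariate series are modelled as \<open>'a fps fps\<close>: the outer variable is \<open>u\<close>, the inner one is \<open>v\<close>.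
\<close>

section \<open>Differentiation in the inner variable\<close>

text \<open>On \<open>'a fps fps\<close>, \<open>fps_deriv\<close> differentiates in
  \<open>u\<close> only; the derivative in \<open>v\<close> has to act on each coefficient
  separately.\<close>

definition fps_inner_deriv :: "'a::comm_ring_1 fps fps \<Rightarrow> 'a fps fps" where
  "fps_inner_deriv f = Abs_fps (\<lambda>i. fps_deriv (f $ i))"

lemma fps_inner_deriv_nth [simp]: "fps_inner_deriv f $ i = fps_deriv (f $ i)"
  by (simp add: fps_inner_deriv_def)

lemma fps_inner_deriv_diff [simp]:
  "fps_inner_deriv (f - g) = fps_inner_deriv f - fps_inner_deriv g"
  by (rule fps_ext) simp

lemma fps_inner_deriv_mult [simp]:
  "fps_inner_deriv (f * g) = f * fps_inner_deriv g + fps_inner_deriv f * g"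
  by (rule fps_ext) (simp add: fps_mult_nth fps_deriv_sum sum.distrib)

lemma fps_inner_deriv_const [simp]: "fps_inner_deriv (fps_const c) = fps_const (fps_deriv c)"
  by (rule fps_ext) simp

lemma fps_inner_deriv_X [simp]: "fps_inner_deriv fps_X = 0"
  by (rule fps_ext) (simp add: fps_X_def)

lemma fps_inner_deriv_one [simp]: "fps_inner_deriv 1 = 0"
  by (rule fps_ext) (simp add: fps_one_nth)

section \<open>Negative binomial series in either variable\<close>

text \<open>The coefficients are those of \<open>(1 - X)\<^sup>-\<^sup>s\<close>.\<close>

definition neg_binomial_fps :: "'a::field_char_0 \<Rightarrow> 'a fps" where
  "neg_binomial_fps s = Abs_fps (\<lambda>k. (s + of_nat k - 1) gchoose k)"

definition outer_neg_binomial_fps :: "'a::field_char_0 \<Rightarrow> 'a fps fps" where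
  "outer_neg_binomial_fps s = Abs_fps (\<lambda>k. fps_const (neg_binomial_fps s $ k))"

lemma neg_binomial_fps_nth: "neg_binomial_fps s $ k = (s + of_nat k - 1) gchoose k"
  by (simp add: neg_binomial_fps_def)

lemma outer_neg_binomial_fps_nth [simp]:
  "outer_neg_binomial_fps s $ k = fps_const (neg_binomial_fps s $ k)"
  by (simp add: outer_neg_binomial_fps_def)

text \<open>Pascal's rule; this is the coefficient form of multiplying by
  \<open>1 - X\<close>.\<close>

lemma neg_binomial_fps_pascal:
  "neg_binomial_fps (s + 1) $ Suc k - neg_binomial_fps (s + 1) $ k = neg_binomial_fps s $ Suc k"
  using gbinomial_Suc_Suc[of "s + of_nat k" k] by (simp add: neg_binomial_fps_nth algebra_simps)

text \<open>Absorption identity for binomial coefficients; it yields the derivative of the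
  series.\<close>

lemma neg_binomial_fps_Suc_nth:
  "of_nat (Suc k) * neg_binomial_fps s $ Suc k = s * neg_binomial_fps (s + 1) $ k"
  using gbinomial_mult_1[of "s + of_nat k" k]
  by (simp add: neg_binomial_fps_nth algebra_simps)

lemma neg_binomial_fps_0: "neg_binomial_fps 0 = 1"
proof (rule fps_ext)
  fix k show "neg_binomial_fps 0 $ k = (1::'a fps) $ k"
    by (cases k) (simp_all add: neg_binomial_fps_nth gbinomial_prod_rev)
qed

lemma neg_binomial_fps_nth_0 [simp]: "neg_binomial_fps s $ 0 = 1"
  by (simp add: neg_binomial_fps_nth)

lemma neg_binomial_fps_shift: "(1 - fps_X) * neg_binomial_fps (s + 1) = neg_binomial_fps s"
proof (rule fps_ext)
  fix k show "((1 - fps_X) * neg_binomial_fps (s + 1)) $ k = neg_binomial_fps s $ k"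
    by (cases k) (use neg_binomial_fps_pascal in \<open>simp_all add: left_diff_distrib\<close>)
qed

lemma neg_binomial_fps_1: "(1 - fps_X) * neg_binomial_fps 1 = 1"
  using neg_binomial_fps_shift[of 0] by (simp add: neg_binomial_fps_0)

lemma neg_binomial_fps_deriv:
  "fps_deriv (neg_binomial_fps s) = fps_const s * neg_binomial_fps (s + 1)"
  by (rule fps_ext) (use neg_binomial_fps_Suc_nth[of _ s] in \<open>simp add: algebra_simps\<close>)

lemma outer_neg_binomial_fps_shift:
  "(1 - fps_X) * outer_neg_binomial_fps (s + 1) = outer_neg_binomial_fps s"
proof (rule fps_ext)
  fix k show "((1 - fps_X) * outer_neg_binomial_fps (s + 1)) $ k = outer_neg_binomial_fps s $ k"
    by (cases k) (simp_all add: left_diff_distrib neg_binomial_fps_pascal)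
qed

lemma outer_neg_binomial_fps_deriv:
  "fps_deriv (outer_neg_binomial_fps s) =
     fps_const (fps_const s) * outer_neg_binomial_fps (s + 1)"
proof (rule fps_ext)
  fix k
  show "fps_deriv (outer_neg_binomial_fps s) $ k =
     (fps_const (fps_const s) * outer_neg_binomial_fps (s + 1)) $ k"
    using neg_binomial_fps_Suc_nth[of k s]
    by (simp flip: fps_of_nat add: algebra_simps)
qed

lemma outer_neg_binomial_fps_inner_deriv [simp]:
  "fps_inner_deriv (outer_neg_binomial_fps s) = 0"
  by (rule fps_ext) simp

lemma outer_neg_binomial_fps_0: "outer_neg_binomial_fps 0 = 1"
  by (rule fps_ext) (simp add: neg_binomial_fps_0 fps_one_nth)

text \<open>Replaces division by \<open>c\<close>, so that it also applies to bivariate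
  series.\<close>

lemma eq_mult_reciprocal:
  fixes a b c r :: "'a::comm_ring_1"
  assumes "c * a = b" and "c * r = 1"
  shows "a = b * r"
proof -
  have "a = (c * r) * a" using assms(2) by simp
  also have "\<dots> = (c * a) * r" by (simp add: ac_simps)
  finally show ?thesis using assms(1) by simp
qed

section \<open>Algebra of the three reciprocals\<close>

context
  fixes u v U V W :: "'a::idom"
  assumes U: "(1 - u) * U = 1" and V: "(1 - v) * V = 1" and W: "(1 - u - v) * W = 1"
begin

text \<open>Follows from \<open>1 - u * v * U * V = (1 - u - v) * U * V\<close> and
  \<open>W - U * V = u * v * U * V * W\<close>.\<close>

lemma kernel_relation: "(u * v * U * V - 1) * (W - U * V) + u * v * U^2 * V^2 = 0"
  using U V W by algebra

text \<open>Multiplied by \<open>F\<close>, the left side is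
  \<open>(\<theta>\<^sub>u \<theta>\<^sub>v - x y) (F (W - U V))\<close>, and the last term on the
  right is \<open>\<theta>\<^sub>u \<theta>\<^sub>v (F U V)\<close>. After expansion only terms with
  the factor \<open>x * y\<close> fail to cancel, and these form
  \<open>kernel_relation\<close>.\<close>

lemma kernel_operator_identity:
  "u * v * (x * y * U * V * (W - U * V) + y * V * (W^2 - U^2 * V) + x * U * (W^2 - U * V^2)
     + (2 * W^3 - U^2 * V^2)) - x * y * (W - U * V)
   = u * v * (x * U * W^2 + y * V * W^2 + 2 * W^3 - (x + 1) * (y + 1) * U^2 * V^2)"
proof -
  have "?thesis \<longleftrightarrow> x * y * ((u * v * U * V - 1) * (W - U * V) + u * v * U^2 * V^2) = 0"
    by (auto simp: algebra_simps power2_eq_square power3_eq_cube)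
  then show ?thesis using kernel_relation by simp
qed

text \<open>Multiplied by \<open>F\<close>, the left side is \<open>(\<theta>\<^sub>u +
  \<theta>\<^sub>v + x + y) (F u v W\<^sup>2)\<close>. It simplifies through
  \<open>u * U + 1 = U\<close>, \<open>v * V + 1 = V\<close> and
  \<open>1 + (u + v) * W = W\<close>.\<close>

lemma summand_operator_identity:
  "u * (x * U * u * v * W^2 + v * W^2 + 2 * u * v * W^3)
     + v * (y * V * u * v * W^2 + u * W^2 + 2 * u * v * W^3) + (x + y) * (u * v * W^2)
   = u * v * (x * U * W^2 + y * V * W^2 + 2 * W^3)"
proof -
  have *: "u * U = U - 1" "v * V = V - 1" "W = 1 + (u + v) * W"
    using U V W by (auto simp: algebra_simps)
  have "u * v * W^2 * (x * (u * U + 1 - U) + y * (v * V + 1 - V)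
      + 2 * (1 + (u + v) * W - W)) = 0"
    using * by simp
  moreover have "?thesis \<longleftrightarrow> u * v * W^2 * (x * (u * U + 1 - U) + y * (v * V + 1 - V)
      + 2 * (1 + (u + v) * W - W)) = 0"
    by (auto simp: algebra_simps power2_eq_square power3_eq_cube)
  ultimately show ?thesis by blast
qed

text \<open>Since \<open>1 - u - v = (1 - v) * (1 - u * V)\<close>, the element \<open>u * W\<close>
  is the geometric series in \<open>u * V\<close>. The remainder is a multiple of
  \<open>u ^ Suc k\<close>, hence invisible to coefficients up to \<open>u ^ k\<close>.\<close>

lemma geometric_remainder: "u * W = (\<Sum>a=1..k. (u * V) ^ a) + u * W * (u * V) ^ k"
proof (induction k)
  case (Suc k)
  have step: "u * V + u * W * (u * V) = u * W"
    using V W by algebra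
  have "(u * V) ^ Suc k + u * W * (u * V) ^ Suc k = (u * V) ^ k * (u * V + u * W * (u * V))"
    by (simp add: distrib_left mult.commute mult.left_commute)
  also have "\<dots> = u * W * (u * V) ^ k"
    unfolding step by (rule mult.commute)
  finally have "(u * V) ^ Suc k + u * W * (u * V) ^ Suc k = u * W * (u * V) ^ k" .
  moreover have "(\<Sum>a=1..Suc k. (u * V) ^ a) + u * W * (u * V) ^ Suc k
      = (\<Sum>a=1..k. (u * V) ^ a) + ((u * V) ^ Suc k + u * W * (u * V) ^ Suc k)"
    by (simp add: add.assoc)
  ultimately show ?case using Suc.IH by metis
qed simp

end

section \<open>The reciprocal of \<open>1 - u - v\<close> and shifts of the exponent\<close>

text \<open>Geometric expansion of \<open>1 / ((1 - v) - u)\<close> in powers of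
  \<open>u\<close>.\<close>

definition recip_one_minus_sum_fps :: "'a::field_char_0 fps fps" where
  "recip_one_minus_sum_fps = Abs_fps (\<lambda>i. neg_binomial_fps 1 ^ Suc i)"

lemma recip_one_minus_sum_fps:
  "(1 - fps_X - fps_const fps_X) * recip_one_minus_sum_fps = 1"
proof (rule fps_ext)
  fix k
  note * = neg_binomial_fps_1[where 'a='a]
  have **: "(1 - fps_X) * (neg_binomial_fps 1 * f) = f" for f :: "'a fps"
    using * by (simp flip: mult.assoc)
  show "((1 - fps_X - fps_const fps_X) * recip_one_minus_sum_fps) $ k = (1::'a fps fps) $ k"
    using * **[of "neg_binomial_fps 1 ^ k"]
    by (cases k) (simp_all add: recip_one_minus_sum_fps_def algebra_simps)
qed

lemma outer_neg_binomial_fps_1: "(1 - fps_X) * outer_neg_binomial_fps 1 = 1"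
  using outer_neg_binomial_fps_shift[of 0] by (simp add: outer_neg_binomial_fps_0)

lemma neg_binomial_fps_add_1:
  "neg_binomial_fps (s + 1) = neg_binomial_fps s * neg_binomial_fps 1"
  by (rule eq_mult_reciprocal[OF neg_binomial_fps_shift neg_binomial_fps_1])

lemma outer_neg_binomial_fps_add_1:
  "outer_neg_binomial_fps (s + 1) = outer_neg_binomial_fps s * outer_neg_binomial_fps 1"
  by (rule eq_mult_reciprocal[OF outer_neg_binomial_fps_shift outer_neg_binomial_fps_1])

lemma neg_binomial_fps_add_nat:
  "neg_binomial_fps (s + of_nat k) = neg_binomial_fps s * neg_binomial_fps 1 ^ k"
proof (induction k)
  case (Suc k)
  then show ?case using neg_binomial_fps_add_1[of "s + of_nat k"] by (simp add: ac_simps)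
qed simp

lemma outer_neg_binomial_fps_add_nat:
  "outer_neg_binomial_fps (s + of_nat k) = outer_neg_binomial_fps s * outer_neg_binomial_fps 1 ^ k"
proof (induction k)
  case (Suc k)
  then show ?case using outer_neg_binomial_fps_add_1[of "s + of_nat k"] by (simp add: ac_simps)
qed simp

text \<open>Differentiating \<open>(1 - u - v) * W = 1\<close> gives
  \<open>(1 - u - v) * W' = W\<close>.\<close>

lemma recip_one_minus_sum_fps_deriv:
  "fps_deriv recip_one_minus_sum_fps = recip_one_minus_sum_fps ^ 2"
proof -
  have "fps_deriv ((1 - fps_X - fps_const fps_X) * recip_one_minus_sum_fps :: 'a fps fps) = 0"
    by (simp only: recip_one_minus_sum_fps fps_deriv_1)
  then have "(1 - fps_X - fps_const fps_X) * fps_deriv recip_one_minus_sum_fps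
      = (recip_one_minus_sum_fps :: 'a fps fps)"
    by simp
  from eq_mult_reciprocal[OF this recip_one_minus_sum_fps] show ?thesis
    by (simp add: power2_eq_square)
qed

lemma recip_one_minus_sum_fps_inner_deriv:
  "fps_inner_deriv recip_one_minus_sum_fps = recip_one_minus_sum_fps ^ 2"
proof -
  have "fps_inner_deriv ((1 - fps_X - fps_const fps_X) * recip_one_minus_sum_fps :: 'a fps fps) = 0"
    by (simp only: recip_one_minus_sum_fps fps_inner_deriv_one)
  then have "(1 - fps_X - fps_const fps_X) * fps_inner_deriv recip_one_minus_sum_fps
      = (recip_one_minus_sum_fps :: 'a fps fps)"
    by simp
  from eq_mult_reciprocal[OF this recip_one_minus_sum_fps] show ?thesis
    by (simp add: power2_eq_square)
qed

section \<open>The double sum as a coefficient\<close>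

text \<open>Of the two factors \<open>W\<close>, one is expanded in powers of \<open>u * V\<close>
  and the other in powers of \<open>v * U\<close>; the exponents of these powers are the summation
  indices \<open>a\<close> and \<open>b\<close>.\<close>

lemma summand_coefficient:
  fixes x y :: "'a::field_char_0"
  defines "W \<equiv> recip_one_minus_sum_fps :: 'a fps fps"
  shows "(outer_neg_binomial_fps x * fps_const (neg_binomial_fps y) * fps_X * fps_const fps_X * W^2) $ m $ n
    = (\<Sum>a=1..m. \<Sum>b=1..n. ((x + of_nat m - of_nat a + of_nat b - 1) gchoose (m - a)) *
        ((y + of_nat n + of_nat a - of_nat b - 1) gchoose (n - b)))"
proof -
  define u where "u = (fps_X :: 'a fps fps)"
  define v where "v = (fps_const fps_X :: 'a fps fps)"
  define U where "U = (outer_neg_binomial_fps 1 :: 'a fps fps)"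
  define V where "V = (fps_const (neg_binomial_fps 1) :: 'a fps fps)"
  define A where "A = outer_neg_binomial_fps x"
  define B where "B = fps_const (neg_binomial_fps y)"
  have U: "(1 - u) * U = 1"
    unfolding u_def U_def by (rule outer_neg_binomial_fps_1)
  have V: "(1 - v) * V = 1"
    unfolding v_def V_def using neg_binomial_fps_1[where 'a='a]
    by (simp flip: fps_const_1_eq_1)
  have W: "(1 - u - v) * W = 1"
    unfolding u_def v_def W_def by (rule recip_one_minus_sum_fps)
  have W': "(1 - v - u) * W = 1" using W by (simp add: algebra_simps)
  define P where "P = (\<Sum>a=1..m. (u * V) ^ a)"
  define Q where "Q = (\<Sum>b=1..n. (v * U) ^ b)"
  have "A * B * u * v * W^2 = A * B * (u * W) * (v * W)"
    by (simp add: power2_eq_square ac_simps)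
  also have "\<dots> = A * B * (P + u * W * (u * V) ^ m) * (v * W)"
    unfolding P_def using geometric_remainder[OF U V W, of m] by simp
  also have "\<dots> = A * B * P * (v * W) + u ^ Suc m * (A * B * W * V ^ m * v * W)"
    by (simp add: algebra_simps power_mult_distrib)
  also have "A * B * P * (v * W) = A * B * P * (Q + v * W * (v * U) ^ n)"
    unfolding Q_def using geometric_remainder[OF V U W', of n] by simp
  also have "\<dots> = A * B * P * Q + v ^ Suc n * (A * B * P * W * U ^ n)"
    by (simp add: algebra_simps power_mult_distrib)
  finally have *: "A * B * u * v * W^2 = A * B * P * Q + v ^ Suc n * (A * B * P * W * U ^ n)
      + u ^ Suc m * (A * B * W * V ^ m * v * W)" .
  \<comment> \<open>Both remainders start beyond the degrees \<open>m\<close> in \<open>u\<close>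
    and \<open>n\<close> in \<open>v\<close>.\<close>
  have u0: "(u ^ Suc m * f) $ m = 0" for f
    unfolding u_def by (simp only: fps_X_power_mult_nth) simp
  have v0: "(v ^ Suc n * f) $ m $ n = 0" for f
    unfolding v_def by (simp only: fps_const_power fps_mult_left_const_nth fps_X_power_mult_nth) simp
  have "A * B * P * Q = (\<Sum>a=1..m. \<Sum>b=1..n. A * B * (u * V) ^ a * (v * U) ^ b)"
    unfolding P_def Q_def by (simp add: sum_distrib_left sum_distrib_right ac_simps)
  \<comment> \<open>The powers \<open>U ^ b\<close> and \<open>V ^ a\<close> are absorbed into the
    exponents, turning \<open>x\<close> into \<open>x + b\<close> and \<open>y\<close> into
    \<open>y + a\<close>.\<close>
  also have "\<dots> = (\<Sum>a=1..m. \<Sum>b=1..n. u ^ a * (outer_neg_binomial_fps (x + of_nat b) *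
      fps_const (fps_X ^ b * neg_binomial_fps (y + of_nat a))))"
    by (simp only: outer_neg_binomial_fps_add_nat neg_binomial_fps_add_nat power_mult_distrib
        A_def B_def u_def v_def U_def V_def fps_const_power ac_simps flip: fps_const_mult)
  finally have "(A * B * P * Q) $ m $ n = (\<Sum>a=1..m. \<Sum>b=1..n. (u ^ a *
      (outer_neg_binomial_fps (x + of_nat b) *
        fps_const (fps_X ^ b * neg_binomial_fps (y + of_nat a)))) $ m $ n)"
    by (simp only: fps_sum_nth)
  also have "\<dots> = (\<Sum>a=1..m. \<Sum>b=1..n.
      neg_binomial_fps (x + of_nat b) $ (m - a) * neg_binomial_fps (y + of_nat a) $ (n - b))"
    by (intro sum.cong refl) (auto simp: u_def fps_X_power_mult_nth)
  also have "\<dots> = (\<Sum>a=1..m. \<Sum>b=1..n. ((x + of_nat m - of_nat a + of_nat b - 1) gchoose (m - a)) *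
        ((y + of_nat n + of_nat a - of_nat b - 1) gchoose (n - b)))"
    by (intro sum.cong refl arg_cong2[where f = "(*)"])
      (auto simp: neg_binomial_fps_nth of_nat_diff algebra_simps)
  finally have "(A * B * u * v * W^2) $ m $ n =
      (\<Sum>a=1..m. \<Sum>b=1..n. ((x + of_nat m - of_nat a + of_nat b - 1) gchoose (m - a)) *
        ((y + of_nat n + of_nat a - of_nat b - 1) gchoose (n - b)))"
    by (simp only: * fps_add_nth u0 v0 fps_zero_nth add_0_right)
  then show ?thesis
    by (simp only: A_def B_def u_def v_def)
qed

section \<open>Euler operators act diagonally on coefficients\<close>

lemma fps_X_deriv_nth: "(fps_X * fps_deriv f) $ i = of_nat i * f $ i"
  by (cases i) simp_all

lemma of_nat_mult_fps_nth: "(of_nat k * f) $ i = of_nat k * f $ i"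
  by (simp flip: fps_of_nat)

lemma outer_euler_nth: "(fps_X * fps_deriv f) $ m $ n = of_nat m * f $ m $ n"
  by (simp only: fps_X_deriv_nth of_nat_mult_fps_nth)

lemma inner_euler_nth:
  "(fps_const fps_X * fps_inner_deriv f) $ m $ n = of_nat n * f $ m $ n"
  by (simp only: fps_mult_left_const_nth fps_inner_deriv_nth fps_X_deriv_nth)

lemma double_euler_nth:
  "(fps_X * fps_const fps_X * fps_deriv (fps_inner_deriv f)) $ m $ n
    = of_nat m * of_nat n * f $ m $ n"
proof -
  have "fps_X * fps_const fps_X * fps_deriv (fps_inner_deriv f)
      = fps_const fps_X * (fps_X * fps_deriv (fps_inner_deriv f))"
    by (simp only: ac_simps)
  also have "\<dots> $ m $ n = (of_nat m * (fps_X * fps_deriv (f $ m))) $ n"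
    unfolding fps_mult_left_const_nth fps_X_deriv_nth fps_inner_deriv_nth
    by (simp only: ac_simps)
  finally show ?thesis
    unfolding of_nat_mult_fps_nth fps_X_deriv_nth by (simp only: ac_simps)
qed

section \<open>The identity with cleared denominator\<close>

lemma double_sum_relation:
  fixes x y :: "'a::field_char_0"
  defines "S \<equiv> (\<lambda>m n. \<Sum>a=1..m. \<Sum>b=1..n.
      ((x + of_nat m - of_nat a + of_nat b - 1) gchoose (m - a)) *
      ((y + of_nat n + of_nat a - of_nat b - 1) gchoose (n - b)))"
  assumes "x * y = of_nat m * of_nat n"
  shows "(of_nat m + of_nat n + x + y) * S m n
    = of_nat m * of_nat n * ((x + of_nat m) gchoose m) * ((y + of_nat n) gchoose n)"
proof -
  define u where "u = (fps_X :: 'a fps fps)"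
  define v where "v = (fps_const fps_X :: 'a fps fps)"
  define U where "U = (outer_neg_binomial_fps 1 :: 'a fps fps)"
  define V where "V = (fps_const (neg_binomial_fps 1) :: 'a fps fps)"
  define W where "W = (recip_one_minus_sum_fps :: 'a fps fps)"
  define A where "A = outer_neg_binomial_fps x"
  define B where "B = fps_const (neg_binomial_fps y)"
  define X where "X = fps_const (fps_const x)"
  define Y where "Y = fps_const (fps_const y)"
  have U: "(1 - u) * U = 1"
    unfolding u_def U_def by (rule outer_neg_binomial_fps_1)
  have V: "(1 - v) * V = 1"
    unfolding v_def V_def using neg_binomial_fps_1[where 'a='a]
    by (simp flip: fps_const_1_eq_1)
  have W: "(1 - u - v) * W = 1"
    unfolding u_def v_def W_def by (rule recip_one_minus_sum_fps)
  have outer: "fps_deriv u = 1" "fps_deriv v = 0" "fps_deriv U = U^2" "fps_deriv V = 0"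
      "fps_deriv W = W^2" "fps_deriv A = X * A * U" "fps_deriv B = 0" "fps_deriv X = 0" "fps_deriv Y = 0"
    using outer_neg_binomial_fps_add_1[of "1::'a"] outer_neg_binomial_fps_add_1[of x]
    by (simp_all add: u_def v_def U_def V_def W_def A_def B_def X_def Y_def
        recip_one_minus_sum_fps_deriv outer_neg_binomial_fps_deriv power2_eq_square mult.assoc)
  have inner: "fps_inner_deriv u = 0" "fps_inner_deriv v = 1" "fps_inner_deriv U = 0"
      "fps_inner_deriv V = V^2" "fps_inner_deriv W = W^2" "fps_inner_deriv A = 0"
      "fps_inner_deriv B = Y * B * V"
    using neg_binomial_fps_add_1[of "1::'a"] neg_binomial_fps_add_1[of y]
    by (simp_all add: u_def v_def U_def V_def W_def A_def B_def Y_def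
        recip_one_minus_sum_fps_inner_deriv neg_binomial_fps_deriv power2_eq_square mult.assoc)
  \<comment> \<open>With \<open>F = A * B\<close>, these are the series for the double sum, for the
    product of binomials, and the auxiliary series on which the operator with eigenvalue
    \<open>m n - x y\<close> acts.\<close>
  define T where "T = A * B * u * v * W^2"
  define R where "R = A * U * (B * V)"
  define G where "G = A * B * (W - U * V)"
  have T_eq: "u * fps_deriv T + v * fps_inner_deriv T + (X + Y) * T
      = A * B * (u * (X * U * u * v * W^2 + v * W^2 + 2 * u * v * W^3)
     + v * (Y * V * u * v * W^2 + u * W^2 + 2 * u * v * W^3) + (X + Y) * (u * v * W^2))"
    by (simp add: T_def outer inner algebra_simps power2_eq_square power3_eq_cube)
  have R_eq: "u * v * fps_deriv (fps_inner_deriv R)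
      = A * B * (u * v * ((X + 1) * (Y + 1) * U^2 * V^2))"
    by (simp add: R_def outer inner algebra_simps power2_eq_square power3_eq_cube)
  have G_eq: "u * v * fps_deriv (fps_inner_deriv G) - X * Y * G
      = A * B * (u * v * (X * Y * U * V * (W - U * V) + Y * V * (W^2 - U^2 * V)
          + X * U * (W^2 - U * V^2) + (2 * W^3 - U^2 * V^2)) - X * Y * (W - U * V))"
    by (simp add: G_def outer inner algebra_simps power2_eq_square power3_eq_cube)
  have "u * fps_deriv T + v * fps_inner_deriv T + (X + Y) * T - u * v * fps_deriv (fps_inner_deriv R)
      = u * v * fps_deriv (fps_inner_deriv G) - X * Y * G"
    unfolding T_eq R_eq G_eq summand_operator_identity[OF U V W] kernel_operator_identity[OF U V W]
    by (simp add: algebra_simps)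
  then have "(u * fps_deriv T + v * fps_inner_deriv T + (X + Y) * T
        - u * v * fps_deriv (fps_inner_deriv R)) $ m $ n
      = (u * v * fps_deriv (fps_inner_deriv G) - X * Y * G) $ m $ n"
    by (rule arg_cong)
  then have "(of_nat m + of_nat n + x + y) * T $ m $ n - of_nat m * of_nat n * R $ m $ n
      = (of_nat m * of_nat n - x * y) * G $ m $ n"
    unfolding u_def v_def X_def Y_def fps_sub_nth fps_add_nth fps_const_add fps_const_mult
      outer_euler_nth inner_euler_nth double_euler_nth
    unfolding fps_mult_left_const_nth
    by (simp only: algebra_simps)
  moreover have "T $ m $ n = S m n"
    unfolding T_def A_def B_def u_def v_def W_def S_def by (rule summand_coefficient)
  moreover have "R $ m $ n = ((x + of_nat m) gchoose m) * ((y + of_nat n) gchoose n)"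
  proof -
    \<comment> \<open>Absorbing \<open>U\<close> and \<open>V\<close> raises both exponents by 1,
      which cancels the \<open>- 1\<close> in \<open>neg_binomial_fps_nth\<close>.\<close>
    have "R = outer_neg_binomial_fps (x + 1) * fps_const (neg_binomial_fps (y + 1))"
      by (simp add: R_def A_def B_def U_def V_def outer_neg_binomial_fps_add_1[of x]
          neg_binomial_fps_add_1[of y])
    then show ?thesis by (simp add: neg_binomial_fps_nth)
  qed
  ultimately show ?thesis using assms(2) by (simp add: mult.assoc)
qed

section \<open>Continuity and the removable singularities\<close>

text \<open>For a fixed lower index the binomial coefficient is a polynomial in its upper
  argument.\<close>

lemma isCont_gbinomial:
  fixes f :: "'a::t2_space \<Rightarrow> 'b::{real_normed_field, field_char_0}"
  assumes "isCont f a"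
  shows "isCont (\<lambda>z. f z gchoose k) a"
  unfolding gbinomial_prod_rev using assms by (intro continuous_intros) auto

theorem theorem1:
  fixes m n :: nat and \<alpha> :: complex
  assumes "\<alpha> \<noteq> 0"
  shows "(m = 0 \<or> n = 0 \<or> closed_denom m n \<alpha> \<noteq> 0 \<longrightarrow> double_sum m n \<alpha> = closed_form m n \<alpha>) \<and>
         (closed_denom m n \<alpha> = 0 \<longrightarrow> (closed_form m n \<longlongrightarrow> double_sum m n \<alpha>) (at \<alpha>))"
proof -
  have eq: "double_sum m n z = closed_form m n z"
    if "z \<noteq> 0" "m = 0 \<or> n = 0 \<or> closed_denom m n z \<noteq> 0" for z
  proof (cases "m = 0 \<or> n = 0")
    case True
    \<comment> \<open>The sums are empty and the numerator \<open>m n\<close> is 0, whatever the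
      denominator is.\<close>
    then show ?thesis by (auto simp: double_sum_def closed_form_def)
  next
    case False
    have "closed_denom m n z = of_nat m + of_nat n + z * of_nat m + inverse z * of_nat n"
      using that(1) by (simp add: closed_denom_def algebra_simps)
    then have "closed_denom m n z * double_sum m n z = of_nat m * of_nat n *
        (((1 + z) * of_nat m) gchoose m) * (((1 + inverse z) * of_nat n) gchoose n)"
      using double_sum_relation[of "z * of_nat m" "inverse z * of_nat n" m n] that(1)
      by (simp add: double_sum_def algebra_simps)
    then show ?thesis using False that(2)
      by (simp add: closed_form_def eq_divide_eq mult.commute)
  qed
  \<comment> \<open>The limit holds at every nonzero \<alpha>: the double sum is continuous there
    and agrees with the closed form on a punctured neighbourhood.\<close>
  have "(closed_form m n \<longlongrightarrow> double_sum m n \<alpha>) (at \<alpha>)"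
  proof -
    have "isCont (double_sum m n) \<alpha>"
      unfolding double_sum_def using assms
      by (intro continuous_intros isCont_gbinomial)
    then have lim: "(double_sum m n \<longlongrightarrow> double_sum m n \<alpha>) (at \<alpha>)"
      by (simp add: isCont_def)
    \<comment> \<open>Besides 0, the excluded points are the zeros of the denominator. For
      \<open>m = 0\<close> the quotient is 0 by convention, and that case is covered by the first
      disjunct below.\<close>
    have "eventually (\<lambda>z. z \<noteq> 0 \<and> z \<noteq> -1 \<and> z \<noteq> - of_nat n / of_nat m) (at \<alpha>)"
      by (intro eventually_conj eventually_neq_at_within)
    then have "eventually (\<lambda>z. double_sum m n z = closed_form m n z) (at \<alpha>)"
    proof eventually_elim
      case (elim z)
      have "m = 0 \<or> closed_denom m n z \<noteq> 0"
      proof (rule disjCI)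
        assume "\<not> closed_denom m n z \<noteq> 0"
        then have "of_nat m + inverse z * of_nat n = 0"
          using elim by (auto simp: closed_denom_def add_eq_0_iff)
        then have "z * of_nat m = - of_nat n"
          using elim by (simp add: field_simps add_eq_0_iff)
        then show "m = 0" using elim
          by (metis nonzero_eq_divide_eq of_nat_eq_0_iff)
      qed
      then show ?case using elim by (intro eq) auto
    qed
    then show ?thesis using lim by (rule Lim_transform_eventually[rotated])
  qed
  then show ?thesis using eq assms by blast
qed

end
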